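(* Let $S \subseteq \mathbb{Z}^+$ be permutable via $\pi\colon \mathbb{N} \to S$, and let $v \in S$. Let $L$ be the number of values in $[1,v)$ placed before $v$, and let $H$ be the number of values in $(v,2v)$ placed before $v$. Then $$L - H \le |S^c \cap (v,2v)| \qquad\text{and}\qquad H - L \le |S^c \cap (0,v)|.$$
   Context: $\mathbb{N} = \{1,2,3,\dots\} = \mathbb{Z}^+$. $S$ is permutable via $\pi$ if $\pi\colon \mathbb{N} \to S$ is a bijection such that no $i<j<k$ have $\pi(i),\pi(j),\pi(k)$ forming an arithmetic progression with $\pi(i)<\pi(j)<\pi(k)$ or $\pi(i)>\pi(j)>\pi(k)$. A value $u \in S$ is placed before $v$ if $\pi^{-1}(u) < \pi^{-1}(v)$. $S^c = \mathbb{Z}^+ \setminus S$; all intervals are intervals of integers. *)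

theory Defs
  imports Main
begin

text \<open>
  The positive integers are represented as the subset \<open>{1..}\<close> of \<^typ>\<open>nat\<close>; they serve both as
  the index set (positions) and as the ambient set of the values. In particular positions
  start at \<open>1\<close>, and the value of \<open>\<pi>\<close> at \<open>0\<close> is irrelevant.
\<close>

abbreviation pos_ints :: "nat set"
  where "pos_ints \<equiv> {1..}"

definition arith_prog3 :: "nat \<Rightarrow> nat \<Rightarrow> nat \<Rightarrow> bool"
  where "arith_prog3 a b c \<longleftrightarrow> int b - int a = int c - int b"

definition permutable_via :: "nat set \<Rightarrow> (nat \<Rightarrow> nat) \<Rightarrow> bool"
  where "permutable_via S \<pi> \<longleftrightarrow>
    bij_betw \<pi> pos_ints S \<and>
    \<not> (\<exists>i\<in>pos_ints. \<exists>j\<in>pos_ints. \<exists>k\<in>pos_ints. i < j \<and> j < k \<and>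
        arith_prog3 (\<pi> i) (\<pi> j) (\<pi> k) \<and>
        ((\<pi> i < \<pi> j \<and> \<pi> j < \<pi> k) \<or> (\<pi> i > \<pi> j \<and> \<pi> j > \<pi> k)))"

text \<open>Only meaningful for \<open>u\<close> and \<open>v\<close> in the image \<open>S\<close> of \<open>\<pi>\<close>.\<close>

definition placed_before :: "(nat \<Rightarrow> nat) \<Rightarrow> nat \<Rightarrow> nat \<Rightarrow> bool"
  where "placed_before \<pi> u v \<longleftrightarrow> inv_into pos_ints \<pi> u < inv_into pos_ints \<pi> v"

definition num_before :: "nat set \<Rightarrow> (nat \<Rightarrow> nat) \<Rightarrow> nat set \<Rightarrow> nat \<Rightarrow> nat"
  where "num_before S \<pi> I v = card {u \<in> S \<inter> I. placed_before \<pi> u v}"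

definition pos_compl :: "nat set \<Rightarrow> nat set"
  where "pos_compl S = pos_ints - S"

end

theory Submission
  imports Defs
begin

text \<open>
  If \<open>u\<close> is placed before \<open>v\<close> and its mirror image \<open>2v - u\<close> lies in \<open>S\<close>, then the mirror image is
  placed before \<open>v\<close> as well, since otherwise \<open>u, v, 2v - u\<close> would be a monotone progression in
  \<open>\<pi>\<close>. So reflection in \<open>v\<close> injects the values placed before \<open>v\<close> on one side into the values on
  the other side that are placed before \<open>v\<close> or missing from \<open>S\<close>.
\<close>

lemma placed_before_reflect:
  assumes perm: "permutable_via S \<pi>"
    and S: "u \<in> S" "v \<in> S" "2 * v - u \<in> S"
    and u: "u \<noteq> v" "u < 2 * v"
    and before: "placed_before \<pi> u v"
  shows "placed_before \<pi> (2 * v - u) v"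
proof (rule ccontr)
  assume not_before: "\<not> placed_before \<pi> (2 * v - u) v"
  let ?p = "inv_into pos_ints \<pi>" and ?w = "2 * v - u"
  have im: "\<pi> ` pos_ints = S"
    and no_ap: "\<And>i j k. \<lbrakk>i \<in> pos_ints; j \<in> pos_ints; k \<in> pos_ints; i < j; j < k;
      arith_prog3 (\<pi> i) (\<pi> j) (\<pi> k)\<rbrakk> \<Longrightarrow>
      \<not> (\<pi> i < \<pi> j \<and> \<pi> j < \<pi> k \<or> \<pi> i > \<pi> j \<and> \<pi> j > \<pi> k)"
    using perm unfolding permutable_via_def bij_betw_def by blast+
  have val: "\<pi> (?p x) = x" and pos: "?p x \<in> pos_ints" if "x \<in> S" for x
    using that im f_inv_into_f[of x \<pi> pos_ints] inv_into_into[of x \<pi> pos_ints] by auto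
  \<comment> \<open>Distinct values have distinct positions, so not being placed before
    \<open>v\<close> will mean standing strictly after it.\<close>
  have "?w \<noteq> v"
    using u by linarith
  then have "?p ?w \<noteq> ?p v"
    using val S by metis
  then have "?p u < ?p v" "?p v < ?p ?w"
    using before not_before unfolding placed_before_def by auto
  moreover have "arith_prog3 u v ?w" "u < v \<and> v < ?w \<or> u > v \<and> v > ?w"
    using u unfolding arith_prog3_def by auto
  ultimately show False
    using no_ap[OF pos[OF S(1)] pos[OF S(2)] pos[OF S(3)], unfolded val[OF S(1)] val[OF S(2)] val[OF S(3)]]
    by blast
qed

text \<open>Arbitrary \<open>I\<close> and \<open>J\<close> let one counting argument serve both
  inequalities, with the two sides of \<open>v\<close> swapping roles.\<close>

lemma num_before_reflect_le:
  assumes perm: "permutable_via S \<pi>" and "v \<in> S"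
    and I: "\<And>u. u \<in> I \<Longrightarrow> u \<noteq> v \<and> u < 2 * v \<and> 2 * v - u \<in> J"
    and "finite J"
  shows "num_before S \<pi> I v \<le> num_before S \<pi> J v + card (pos_compl S \<inter> J)"
proof -
  let ?A = "{u \<in> S \<inter> I. placed_before \<pi> u v}" and ?B = "{u \<in> S \<inter> J. placed_before \<pi> u v}"
  have "2 * v - u \<in> ?B \<union> pos_compl S \<inter> J" if "u \<in> ?A" for u
  proof (cases "2 * v - u \<in> S")
    case True
    then show ?thesis
      using that I[of u] placed_before_reflect[OF perm _ \<open>v \<in> S\<close>, of u] by simp
  next
    case False
    \<comment> \<open>\<open>u < 2 * v\<close> makes the truncated difference at least 1, so it lies
      in \<open>pos_compl S\<close>.\<close>
    then show ?thesis
      using that I[of u] by (simp add: pos_compl_def Suc_le_eq)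
  qed
  then have "(\<lambda>u. 2 * v - u) ` ?A \<subseteq> ?B \<union> pos_compl S \<inter> J"
    by blast
  moreover have "inj_on (\<lambda>u. 2 * v - u) ?A"
  proof (rule inj_onI)
    fix x y assume xy: "x \<in> ?A" "y \<in> ?A" and eq: "2 * v - x = 2 * v - y"
    \<comment> \<open>Truncated subtraction sends everything above \<open>2 * v\<close> to 0; up to
      \<open>2 * v\<close> it is injective.\<close>
    have "x \<le> 2 * v" "y \<le> 2 * v"
      using xy I[of x] I[of y] by simp_all
    then show "x = y"
      using eq by simp
  qed
  moreover have "finite (?B \<union> pos_compl S \<inter> J)"
    using \<open>finite J\<close> by simp
  ultimately have "card ?A \<le> card (?B \<union> pos_compl S \<inter> J)"
    by (intro card_inj_on_le)
  also have "\<dots> \<le> card ?B + card (pos_compl S \<inter> J)"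
    by (rule card_Un_le)
  finally show ?thesis
    by (simp add: num_before_def)
qed

theorem lemma5:
  fixes S :: "nat set" and \<pi> :: "nat \<Rightarrow> nat" and v L H :: nat
  assumes "S \<subseteq> pos_ints"
    and "permutable_via S \<pi>"
    and "v \<in> S"
    and "L = num_before S \<pi> {1..<v} v"
    and "H = num_before S \<pi> {v<..<2 * v} v"
  shows "int L - int H \<le> int (card (pos_compl S \<inter> {v<..<2 * v})) \<and>
         int H - int L \<le> int (card (pos_compl S \<inter> {0<..<v}))"
proof -
  \<comment> \<open>The open form serves as \<open>I\<close> for the first inequality and as
    \<open>J\<close> for the second, where it matches the complement term.\<close>
  have "{1..<v} = {0<..<v}"
    by auto
  then have L: "L = num_before S \<pi> {0<..<v} v"
    using assms(4) by simp
  have "L \<le> H + card (pos_compl S \<inter> {v<..<2 * v})"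
    unfolding L assms(5) by (rule num_before_reflect_le[OF assms(2,3)]) auto
  moreover have "H \<le> L + card (pos_compl S \<inter> {0<..<v})"
    unfolding L assms(5) by (rule num_before_reflect_le[OF assms(2,3)]) auto
  ultimately show ?thesis
    by linarith
qed

end
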